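(* Let $a$ be a positive integer. Let $\mathbf{S}\in\mathbb{Q}[[t_1,\dots,t_{2a}]]$ be the unique formal power series with constant term $1$ satisfying $$0=1-\mathbf{S}+\sum_{k=1}^{2a} t_k\,\mathbf{S}^{k+1},$$ and let $\mathbf{G}[t_1,\dots,t_{2a}]\in\mathbb{Q}[[t_1,\dots,t_{2a}]]$ be the formal power series with $\mathbf{S}-1=(t_1+t_2+\cdots+t_{2a})\,\mathbf{G}$. Then substituting $t_{2j-1}=-f$ and $t_{2j}=f$ for $j=1,\dots,a$ gives $$\mathbf{G}[-f,f,-f,f,\dots,-f,f]=\sum_{n\ge0}a^n f^n$$ as formal power series in $f$.
   Context: Here $\mathbf{S}$ is the series solution $\alpha$ of $0=1-\alpha+\sum_{k=1}^{2a}t_k\alpha^{k+1}$ (the variable $t_k$ multiplies $\alpha^{k+1}$). It is known that $\mathbf{S}-1$ is divisible by $t_1+\cdots+t_{2a}$ in the ring of formal power series, so $\mathbf{G}$ (the "Geode series", equivalently the general Geode series in $t_1,t_2,\dots$ with $t_k=0$ for $k>2a$) is a well-defined formal power series; the substitution is performed in $\mathbf{G}$ itself (even though $t_1+\cdots+t_{2a}$ becomes $0$ under it). *)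

theory Defs
  imports
    "HOL-Library.Multiset"
    "HOL-Computational_Algebra.Formal_Power_Series"
begin

text \<open>
  Formal power series in commuting variables indexed by \<open>'v\<close>, with coefficients in \<open>'a\<close>.
  The monomial $\prod_v t_v^{e_v}$ is represented by the multiset in which \<open>v\<close> has
  multiplicity $e_v$, so multiplication of monomials is addition of multisets and the total
  degree is \<open>size\<close>.
\<close>

typedef ('v, 'a) mfps = "UNIV :: ('v multiset \<Rightarrow> 'a) set"
  morphisms mfps_coeff Abs_mfps
  by simp

lemma mfps_coeff_Abs [simp]: "mfps_coeff (Abs_mfps f) = f"
  by (simp add: Abs_mfps_inverse)

lemma mfps_eqI: "(\<And>M. mfps_coeff F M = mfps_coeff G M) \<Longrightarrow> F = G"
  by (metis ext mfps_coeff_inverse)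

lemma finite_mset_antidiagonal: "finite {(A, B). A + B = (M :: 'v multiset)}"
proof (rule finite_subset)
  show "{(A, B). A + B = M} \<subseteq>
          (\<Union>n\<le>size M. multisets_of_size (set_mset M) n) \<times>
          (\<Union>n\<le>size M. multisets_of_size (set_mset M) n)"
    by (auto simp: multisets_of_size_def)
qed auto

instantiation mfps :: (type, zero) zero
begin
definition zero_mfps_def: "0 = Abs_mfps (\<lambda>_. 0)"
instance ..
end

instantiation mfps :: (type, "{zero, one}") one
begin
definition one_mfps_def: "1 = Abs_mfps (\<lambda>M. if M = {#} then 1 else 0)"
instance ..
end

instantiation mfps :: (type, plus) plus
begin
definition plus_mfps_def: "F + G = Abs_mfps (\<lambda>M. mfps_coeff F M + mfps_coeff G M)"
instance ..
end

instantiation mfps :: (type, minus) minus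
begin
definition minus_mfps_def: "F - G = Abs_mfps (\<lambda>M. mfps_coeff F M - mfps_coeff G M)"
instance ..
end

instantiation mfps :: (type, uminus) uminus
begin
definition uminus_mfps_def: "- F = Abs_mfps (\<lambda>M. - mfps_coeff F M)"
instance ..
end

instantiation mfps :: (type, "{comm_monoid_add, times}") times
begin
definition times_mfps_def:
  "F * G = Abs_mfps (\<lambda>M. \<Sum>(A, B) \<in> {(A, B). A + B = M}. mfps_coeff F A * mfps_coeff G B)"
instance ..
end

lemma mfps_coeff_0 [simp]: "mfps_coeff 0 M = 0"
  by (simp add: zero_mfps_def)

lemma mfps_coeff_1: "mfps_coeff 1 M = (if M = {#} then 1 else 0)"
  by (simp add: one_mfps_def)

lemma mfps_coeff_add [simp]: "mfps_coeff (F + G) M = mfps_coeff F M + mfps_coeff G M"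
  by (simp add: plus_mfps_def)

lemma mfps_coeff_diff [simp]: "mfps_coeff (F - G) M = mfps_coeff F M - mfps_coeff G M"
  by (simp add: minus_mfps_def)

lemma mfps_coeff_uminus [simp]: "mfps_coeff (- F) M = - mfps_coeff F M"
  by (simp add: uminus_mfps_def)

lemma mfps_coeff_mult:
  "mfps_coeff (F * G) M = (\<Sum>(A, B) \<in> {(A, B). A + B = M}. mfps_coeff F A * mfps_coeff G B)"
  by (simp add: times_mfps_def)

instance mfps :: (type, comm_ring_1) comm_ring_1
proof
  fix F G H :: "('a, 'b) mfps"
  show "F + G + H = F + (G + H)"
    by (rule mfps_eqI) (simp add: add.assoc)
  show "F + G = G + F"
    by (rule mfps_eqI) (simp add: add.commute)
  show "0 + F = F"
    by (rule mfps_eqI) simp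
  show "- F + F = 0"
    by (rule mfps_eqI) simp
  show "F - G = F + - G"
    by (rule mfps_eqI) simp
  show "F * G = G * F"
  proof (rule mfps_eqI)
    fix M
    show "mfps_coeff (F * G) M = mfps_coeff (G * F) M"
      unfolding mfps_coeff_mult
      by (rule sum.reindex_bij_witness[of _ prod.swap prod.swap])
         (auto simp: add.commute mult.commute)
  qed
  show "1 * F = F"
  proof (rule mfps_eqI)
    fix M
    have "mfps_coeff (1 * F) M =
            (\<Sum>(A, B) \<in> {({#} :: 'a multiset, M)}. mfps_coeff 1 A * mfps_coeff F B)"
      unfolding mfps_coeff_mult
      by (rule sum.mono_neutral_right)
         (auto simp: mfps_coeff_1 finite_mset_antidiagonal split: if_splits)
    then show "mfps_coeff (1 * F) M = mfps_coeff F M"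
      by (simp add: mfps_coeff_1)
  qed
  show "(F + G) * H = F * H + G * H"
    by (rule mfps_eqI)
       (simp add: mfps_coeff_mult distrib_right sum.distrib case_prod_unfold)
  show "F * G * H = F * (G * H)"
  proof (rule mfps_eqI)
    fix M
    define c where "c = (\<lambda>A B C. mfps_coeff F A * mfps_coeff G B * mfps_coeff H C)"
    have "mfps_coeff (F * G * H) M =
            (\<Sum>(D, C) \<in> {(D, C). D + C = M}. \<Sum>(A, B) \<in> {(A, B). A + B = D}. c A B C)"
      by (simp add: mfps_coeff_mult c_def sum_distrib_right case_prod_unfold)
    also have "\<dots> = (\<Sum>(p, q) \<in> (SIGMA p:{(D, C). D + C = M}. {(A, B). A + B = fst p}).
                      c (fst q) (snd q) (snd p))"
      by (subst sum.Sigma [symmetric])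
         (auto simp: finite_mset_antidiagonal [unfolded case_prod_unfold] case_prod_unfold)
    also have "\<dots> = (\<Sum>(p, q) \<in> (SIGMA p:{(A, D). A + D = M}. {(B, C). B + C = snd p}).
                      c (fst p) (fst q) (snd q))"
      by (rule sum.reindex_bij_witness
            [where i = "\<lambda>((A, D), (B, C)). ((A + B, C), (A, B))"
               and j = "\<lambda>((D, C), (A, B)). ((A, B + C), (B, C))"])
         (auto simp: add.assoc)
    also have "\<dots> = (\<Sum>(A, D) \<in> {(A, D). A + D = M}. \<Sum>(B, C) \<in> {(B, C). B + C = D}. c A B C)"
      by (subst sum.Sigma [symmetric])
         (auto simp: finite_mset_antidiagonal [unfolded case_prod_unfold] case_prod_unfold)
    also have "\<dots> = mfps_coeff (F * (G * H)) M"
      by (simp add: mfps_coeff_mult c_def sum_distrib_left case_prod_unfold mult.assoc)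
    finally show "mfps_coeff (F * G * H) M = mfps_coeff (F * (G * H)) M" .
  qed
  show "(0 :: ('a, 'b) mfps) \<noteq> 1"
  proof
    assume "(0 :: ('a, 'b) mfps) = 1"
    then have "mfps_coeff (0 :: ('a, 'b) mfps) {#} = mfps_coeff (1 :: ('a, 'b) mfps) {#}"
      by simp
    then show False by (simp add: mfps_coeff_1)
  qed
qed

definition mfps_var :: "'v \<Rightarrow> ('v, 'a :: {zero, one}) mfps" where
  "mfps_var v = Abs_mfps (\<lambda>M. if M = {#v#} then 1 else 0)"

abbreviation mfps_const_term :: "('v, 'a) mfps \<Rightarrow> 'a" where
  "mfps_const_term F \<equiv> mfps_coeff F {#}"

text \<open>
  The subring $R[[t_v : v \in V]]$. Only finite \<open>V\<close> are used here; for infinite \<open>V\<close> the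
  elements may involve infinitely many variables.
\<close>

definition mfps_in :: "'v set \<Rightarrow> ('v, 'a :: zero) mfps set" where
  "mfps_in V = {F. \<forall>M. mfps_coeff F M \<noteq> 0 \<longrightarrow> set_mset M \<subseteq> V}"

text \<open>
  The substitution $t_v \mapsto g_v$ for $v \in V$ into a series in the variables \<open>V\<close>, where \<open>V\<close> is
  finite and every $g_v$ has constant term \<open>0\<close>. Under these conditions a monomial of total
  degree greater than \<open>n\<close> contributes nothing to the \<open>n\<close>-th coefficient, so the sum below is finite
  and gives all of the coefficient of $\sum_M c_M \prod_{v \in M} g_v$.
\<close>

definition mfps_subst ::
    "'v set \<Rightarrow> ('v \<Rightarrow> 'a :: comm_ring_1 fps) \<Rightarrow> ('v, 'a) mfps \<Rightarrow> 'a fps" where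
  "mfps_subst V g F = Abs_fps (\<lambda>n.
     \<Sum>M \<in> {M. set_mset M \<subseteq> V \<and> size M \<le> n}. mfps_coeff F M * fps_nth (\<Prod>v\<in>#M. g v) n)"

text \<open>
  The rest of this theory shows that the series defined by the functional equation below, and its
  quotient by the sum of the variables, exist and are unique.
\<close>

lemma mfps_coeff_var: "mfps_coeff (mfps_var v) M = (if M = {#v#} then 1 else 0)"
  by (simp add: mfps_var_def)

lemma mfps_coeff_sum: "mfps_coeff (\<Sum>i\<in>I. F i) M = (\<Sum>i\<in>I. mfps_coeff (F i) M)"
  by (induction I rule: infinite_finite_induct) auto

lemma mfps_const_term_mult:
  "mfps_const_term (F * G) = mfps_const_term F * mfps_const_term G"
proof -
  have "{(A, B). A + B = ({#} :: 'a multiset)} = {({#}, {#})}" by auto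
  then show ?thesis by (simp add: mfps_coeff_mult)
qed

lemma mfps_coeff_var_mult:
  fixes F :: "('v, 'a :: comm_ring_1) mfps"
  shows "mfps_coeff (mfps_var v * F) M = (if v \<in># M then mfps_coeff F (M - {#v#}) else 0)"
proof (cases "v \<in># M")
  case True
  have "mfps_coeff (mfps_var v * F) M =
          (\<Sum>(A, B) \<in> {({#v#}, M - {#v#})}. mfps_coeff (mfps_var v) A * mfps_coeff F B)"
    unfolding mfps_coeff_mult
    by (rule sum.mono_neutral_right)
       (use True in \<open>auto simp: mfps_coeff_var finite_mset_antidiagonal split: if_splits\<close>)
  with True show ?thesis by (simp add: mfps_coeff_var)
next
  case False
  have "mfps_coeff (mfps_var v * F) M = 0"
    unfolding mfps_coeff_mult
    by (rule sum.neutral) (use False in \<open>auto simp: mfps_coeff_var\<close>)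
  with False show ?thesis by simp
qed

lemma mfps_in_add: "F \<in> mfps_in V \<Longrightarrow> G \<in> mfps_in V \<Longrightarrow> F + G \<in> mfps_in V"
  for F G :: "('v, 'a :: comm_ring_1) mfps"
  by (auto simp: mfps_in_def) (metis add_0 subsetD)

lemma mfps_in_1: "(1 :: ('v, 'a :: comm_ring_1) mfps) \<in> mfps_in V"
  by (auto simp: mfps_in_def mfps_coeff_1)

lemma mfps_in_0: "(0 :: ('v, 'a :: comm_ring_1) mfps) \<in> mfps_in V"
  by (auto simp: mfps_in_def)

lemma mfps_in_var: "v \<in> V \<Longrightarrow> (mfps_var v :: ('v, 'a :: comm_ring_1) mfps) \<in> mfps_in V"
  by (auto simp: mfps_in_def mfps_coeff_var)

lemma mfps_in_mult:
  fixes F G :: "('v, 'a :: comm_ring_1) mfps"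
  assumes "F \<in> mfps_in V" "G \<in> mfps_in V"
  shows "F * G \<in> mfps_in V"
  unfolding mfps_in_def
proof (intro CollectI allI impI)
  fix M assume "mfps_coeff (F * G) M \<noteq> 0"
  then obtain A B where "A + B = M" "mfps_coeff F A * mfps_coeff G B \<noteq> 0"
    unfolding mfps_coeff_mult by (force elim: sum.not_neutral_contains_not_neutral)
  moreover from this have "mfps_coeff F A \<noteq> 0" "mfps_coeff G B \<noteq> 0"
    by auto
  ultimately show "set_mset M \<subseteq> V"
    using assms by (force simp: mfps_in_def)
qed

lemma mfps_in_power: "F \<in> mfps_in V \<Longrightarrow> F ^ n \<in> mfps_in V"
  for F :: "('v, 'a :: comm_ring_1) mfps"
  by (induction n) (auto simp: mfps_in_1 mfps_in_mult)

lemma mfps_in_sum: "(\<And>i. i \<in> I \<Longrightarrow> F i \<in> mfps_in V) \<Longrightarrow> (\<Sum>i\<in>I. F i) \<in> mfps_in V"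
  for F :: "'i \<Rightarrow> ('v, 'a :: comm_ring_1) mfps"
  by (induction I rule: infinite_finite_induct) (auto simp: mfps_in_0 mfps_in_add)

definition mfps_agree :: "nat \<Rightarrow> ('v, 'a) mfps \<Rightarrow> ('v, 'a) mfps \<Rightarrow> bool" where
  "mfps_agree n F G \<longleftrightarrow> (\<forall>M. size M < n \<longrightarrow> mfps_coeff F M = mfps_coeff G M)"

lemma mfps_agree_refl: "mfps_agree n F F"
  by (simp add: mfps_agree_def)

lemma mfps_agree_add: "mfps_agree n F F' \<Longrightarrow> mfps_agree n G G' \<Longrightarrow> mfps_agree n (F + G) (F' + G')"
  by (simp add: mfps_agree_def)

lemma mfps_agree_sum:
  "(\<And>i. i \<in> I \<Longrightarrow> mfps_agree n (F i) (G i)) \<Longrightarrow> mfps_agree n (\<Sum>i\<in>I. F i) (\<Sum>i\<in>I. G i)"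
  by (simp add: mfps_agree_def mfps_coeff_sum)

lemma mfps_agree_mult:
  assumes "mfps_agree n F F'" "mfps_agree n G G'"
  shows "mfps_agree n (F * G) (F' * G')"
  using assms unfolding mfps_agree_def mfps_coeff_mult
  by (auto intro!: sum.cong)

lemma mfps_agree_power: "mfps_agree n F G \<Longrightarrow> mfps_agree n (F ^ k) (G ^ k)"
  for F :: "('v, 'a :: comm_ring_1) mfps"
  by (induction k) (auto simp: mfps_agree_refl mfps_agree_mult)

lemma mfps_agree_mult_Suc:
  fixes F G H :: "('v, 'a :: comm_ring_1) mfps"
  assumes "mfps_const_term H = 0" "mfps_agree n F G"
  shows "mfps_agree (Suc n) (H * F) (H * G)"
  unfolding mfps_agree_def mfps_coeff_mult
proof (intro allI impI sum.cong refl, clarify)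
  fix A B :: "'v multiset" assume "size (A + B) < Suc n"
  then have "A = {#} \<or> size B < n"
    by (cases A) auto
  then show "mfps_coeff H A * mfps_coeff F B = mfps_coeff H A * mfps_coeff G B"
    using assms by (auto simp: mfps_agree_def)
qed

lemma mfps_ex1_fixpoint:
  fixes \<Phi> :: "('v, 'a :: comm_ring_1) mfps \<Rightarrow> ('v, 'a) mfps"
  assumes contr: "\<And>n F G. mfps_agree n F G \<Longrightarrow> mfps_agree (Suc n) (\<Phi> F) (\<Phi> G)"
    and closed: "\<And>F. F \<in> mfps_in V \<Longrightarrow> \<Phi> F \<in> mfps_in V"
  shows "\<exists>F \<in> mfps_in V. F = \<Phi> F" "F = \<Phi> F \<Longrightarrow> G = \<Phi> G \<Longrightarrow> F = G"
proof -
  define X where "X = (\<lambda>n. (\<Phi> ^^ n) 0)"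
  have X_Suc: "X (Suc n) = \<Phi> (X n)" for n by (simp add: X_def)
  have step: "mfps_agree n (X n) (X (Suc n))" for n
    by (induction n) (auto simp: X_Suc intro: contr, simp add: mfps_agree_def)
  have agree: "mfps_agree n (X n) (X (n + k))" for n k
  proof (induction k)
    case (Suc k)
    then show ?case using step[of "n + k"] by (auto simp: mfps_agree_def)
  qed (simp add: mfps_agree_refl)
  have X_in: "X n \<in> mfps_in V" for n
    by (induction n) (auto simp: X_Suc closed, simp add: X_def mfps_in_0)
  define L where "L = Abs_mfps (\<lambda>M. mfps_coeff (X (Suc (size M))) M)"
  have L: "mfps_agree n (X n) L" for n
    unfolding mfps_agree_def
  proof (intro allI impI)
    fix M :: "'v multiset" assume "size M < n"
    then obtain k where "n = Suc (size M) + k" by (metis less_iff_Suc_add add_Suc)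
    then show "mfps_coeff (X n) M = mfps_coeff L M"
      using agree[of "Suc (size M)" k] by (simp add: mfps_agree_def L_def)
  qed
  have "L = \<Phi> L"
  proof (rule mfps_eqI)
    fix M :: "'v multiset"
    have "mfps_agree (Suc (size M)) (X (Suc (size M))) (\<Phi> L)"
      unfolding X_Suc by (rule contr[OF L])
    then show "mfps_coeff L M = mfps_coeff (\<Phi> L) M"
      by (simp add: mfps_agree_def L_def)
  qed
  moreover have "L \<in> mfps_in V"
    using X_in unfolding mfps_in_def L_def by auto
  ultimately show "\<exists>F \<in> mfps_in V. F = \<Phi> F" by blast
  assume F: "F = \<Phi> F" and G: "G = \<Phi> G"
  have "mfps_agree n F G" for n
  proof (induction n)
    case (Suc n)
    then show ?case using contr[of n F G] F G by simp
  qed (simp add: mfps_agree_def)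
  then show "F = G"
    by (auto intro!: mfps_eqI simp: mfps_agree_def)
qed

lemma mfps_sum_var_mult_cancel:
  fixes F :: "(nat, 'a :: comm_ring_1) mfps"
  assumes "finite V" "v \<in> V" and eq: "(\<Sum>k\<in>V. mfps_var k) * F = 0"
  shows "F = 0"
proof (rule mfps_eqI)
  fix M
  show "mfps_coeff F M = mfps_coeff 0 M"
  proof (induction "size M - count M v" arbitrary: M rule: less_induct)
    case less
    let ?N = "add_mset v M"
    have "0 = mfps_coeff ((\<Sum>k\<in>V. mfps_var k) * F) ?N"
      by (simp add: eq)
    also have "\<dots> = (\<Sum>k\<in>V. if k \<in># ?N then mfps_coeff F (?N - {#k#}) else 0)"
      by (simp only: sum_distrib_right mfps_coeff_sum mfps_coeff_var_mult)
    also have "\<dots> = (\<Sum>k\<in>{v}. if k \<in># ?N then mfps_coeff F (?N - {#k#}) else 0)"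
    proof (rule sum.mono_neutral_right)
      show "\<forall>k\<in>V - {v}. (if k \<in># ?N then mfps_coeff F (?N - {#k#}) else 0) = 0"
      proof (intro ballI)
        fix k assume k: "k \<in> V - {v}"
        show "(if k \<in># ?N then mfps_coeff F (?N - {#k#}) else 0) = 0"
        proof (cases "k \<in># M")
          case True
          with k obtain M' where M': "M = add_mset k M'" by (metis insert_DiffM)
          have "count M' v \<le> size M'" by (rule count_le_size)
          with k M' have "size (?N - {#k#}) - count (?N - {#k#}) v < size M - count M v"
            by auto
          from less[OF this] show ?thesis by simp
        qed (use k in auto)
      qed
    qed (use assms in auto)
    finally show ?case by simp
  qed
qed

lemma geode_functional_equation_ex1:
  "\<exists>!S. S \<in> mfps_in {1..m} \<and> mfps_const_term S = 1 \<and>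
        0 = 1 - S + (\<Sum>k = 1..m. mfps_var k * (S :: (nat, 'a :: comm_ring_1) mfps) ^ (k + 1))"
proof -
  define \<Phi> :: "(nat, 'a) mfps \<Rightarrow> (nat, 'a) mfps"
    where "\<Phi> = (\<lambda>S. 1 + (\<Sum>k = 1..m. mfps_var k * S ^ (k + 1)))"
  have contr: "mfps_agree (Suc n) (\<Phi> F) (\<Phi> G)" if "mfps_agree n F G" for n F G
    unfolding \<Phi>_def
    by (intro mfps_agree_add mfps_agree_refl mfps_agree_sum mfps_agree_mult_Suc
          mfps_agree_power that) (simp add: mfps_coeff_var)
  have closed: "\<Phi> F \<in> mfps_in {1..m}" if "F \<in> mfps_in {1..m}" for F
    unfolding \<Phi>_def
    by (intro mfps_in_add mfps_in_1 mfps_in_sum mfps_in_mult mfps_in_var mfps_in_power that)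
  have iff: "0 = 1 - S + (\<Sum>k = 1..m. mfps_var k * S ^ (k + 1)) \<longleftrightarrow> S = \<Phi> S" for S
    unfolding \<Phi>_def by (auto simp: algebra_simps)
  have "mfps_const_term (\<Phi> S) = 1" for S
    by (simp add: \<Phi>_def mfps_coeff_sum mfps_const_term_mult mfps_coeff_var mfps_coeff_1)
  then show ?thesis
    unfolding iff using mfps_ex1_fixpoint[of \<Phi> "{1..m}", OF contr closed] by metis
qed

lemma geode_ex1:
  fixes S :: "(nat, 'a :: comm_ring_1) mfps"
  assumes "m > 0" and S: "S \<in> mfps_in {1..m}"
    and eq: "0 = 1 - S + (\<Sum>k = 1..m. mfps_var k * S ^ (k + 1))"
  shows "\<exists>!G. G \<in> mfps_in {1..m} \<and> S - 1 = (\<Sum>k = 1..m. mfps_var k) * G"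
proof (rule ex_ex1I)
  define T :: "(nat, 'a) mfps" where "T = (\<Sum>k = 1..m. mfps_var k)"
  define U where "U = (\<Sum>k = 1..m. mfps_var k * (\<Sum>i<k + 1. S ^ i))"
  define \<Phi> where "\<Phi> = (\<lambda>G. 1 + U * G)"
  have U0: "mfps_const_term U = 0"
    by (simp add: U_def mfps_coeff_sum mfps_const_term_mult mfps_coeff_var)
  have U_in: "U \<in> mfps_in {1..m}"
    unfolding U_def by (intro mfps_in_sum mfps_in_mult mfps_in_var mfps_in_power S)
  have contr: "mfps_agree (Suc n) (\<Phi> F) (\<Phi> G)" if "mfps_agree n F G" for n F G
    unfolding \<Phi>_def by (intro mfps_agree_add mfps_agree_refl mfps_agree_mult_Suc U0 that)
  have closed: "\<Phi> F \<in> mfps_in {1..m}" if "F \<in> mfps_in {1..m}" for F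
    unfolding \<Phi>_def by (intro mfps_in_add mfps_in_1 mfps_in_mult U_in that)
  obtain G where G: "G \<in> mfps_in {1..m}" "G = 1 + U * G"
    using mfps_ex1_fixpoint(1)[of \<Phi> "{1..m}", OF contr closed] by (auto simp: \<Phi>_def)
  have "S - 1 = (\<Sum>k = 1..m. mfps_var k * S ^ (k + 1))"
    using eq by (simp add: algebra_simps)
  also have "\<dots> = (\<Sum>k = 1..m. mfps_var k + (S - 1) * (mfps_var k * (\<Sum>i<k + 1. S ^ i)))"
  proof (rule sum.cong)
    fix k
    have "S ^ (k + 1) = 1 + (S - 1) * (\<Sum>i<k + 1. S ^ i)"
      using power_diff_1_eq[of S "k + 1"] by (metis add.commute diff_add_cancel)
    then have "mfps_var k * S ^ (k + 1) = mfps_var k * (1 + (S - 1) * (\<Sum>i<k + 1. S ^ i))"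
      by (rule arg_cong)
    also have "\<dots> = mfps_var k + (S - 1) * (mfps_var k * (\<Sum>i<k + 1. S ^ i))"
      by (simp only: distrib_left mult_1_right mult.left_commute)
    finally show "mfps_var k * S ^ (k + 1) =
      mfps_var k + (S - 1) * (mfps_var k * (\<Sum>i<k + 1. S ^ i))" .
  qed simp
  also have "\<dots> = T + (S - 1) * U"
    by (simp only: sum.distrib T_def U_def sum_distrib_left)
  finally have 1: "S - 1 = T + (S - 1) * U" .
  have "S - 1 = (S - 1) * (G - U * G)"
    using G(2) by (metis add_diff_cancel_right' mult_1_right)
  also have "\<dots> = ((S - 1) - (S - 1) * U) * G"
    by (simp add: algebra_simps)
  also have "(S - 1) - (S - 1) * U = T"
    using 1 by (metis add_diff_cancel_right')
  finally show "\<exists>G. G \<in> mfps_in {1..m} \<and> S - 1 = (\<Sum>k = 1..m. mfps_var k) * G"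
    using G(1) unfolding T_def by blast
next
  fix G G' :: "(nat, 'a) mfps"
  assume "G \<in> mfps_in {1..m} \<and> S - 1 = (\<Sum>k = 1..m. mfps_var k) * G"
    and "G' \<in> mfps_in {1..m} \<and> S - 1 = (\<Sum>k = 1..m. mfps_var k) * G'"
  then have "(\<Sum>k = 1..m. mfps_var k) * (G - G') = 0"
    by (simp add: right_diff_distrib)
  then have "G - G' = 0"
    using mfps_sum_var_mult_cancel[of "{1..m}" 1 "G - G'"] \<open>m > 0\<close> by simp
  then show "G = G'" by simp
qed

end

theory Submission
  imports Defs
begin

text \<open>
  Put $T = \sum_k t_k$ and $U = \sum_k t_k (1 + S + \cdots + S^k)$. Expanding $S^{k+1}$ around
  $S = 1$ in the functional equation gives $S - 1 = T + (S - 1) U$; after inserting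
  $S - 1 = T G$ the factor $T$ cancels, and $G = 1 + U G$. The substitution is a ring
  homomorphism that kills $T$, hence sends $S$ to $1$ and $U$ to
  $\sum_k (-1)^k (k + 1) f = a f$. So the image of $G$ satisfies $g = 1 + a f g$.
\<close>

text \<open>Every factor is divisible by \<open>fps_X\<close>, so the product over \<open>M\<close>
  is divisible by \<open>fps_X ^ size M\<close>.\<close>

lemma fps_nth_prod_mset_eq_0:
  fixes g :: "'v \<Rightarrow> 'a :: comm_ring_1 fps"
  assumes "\<And>v. v \<in># M \<Longrightarrow> fps_nth (g v) 0 = 0" and "n < size M"
  shows "fps_nth (\<Prod>v\<in>#M. g v) n = 0"
  using assms
proof (induction M arbitrary: n)
  case (add v M)
  have "fps_nth (g v) i * fps_nth (\<Prod>v\<in>#M. g v) (n - i) = 0" if "i \<le> n" for i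
    using add that by (cases i) auto
  then show ?case
    by (simp add: fps_mult_nth)
qed simp

lemma finite_bounded_multisets:
  assumes "finite V"
  shows "finite {M. set_mset M \<subseteq> V \<and> size M \<le> n}"
proof (rule finite_subset)
  show "{M. set_mset M \<subseteq> V \<and> size M \<le> n} \<subseteq> (\<Union>k\<le>n. multisets_of_size V k)"
    by (auto simp: multisets_of_size_def)
qed (use assms in auto)

text \<open>\<open>mfps_subst\<close> truncates at a degree that changes with the coefficient. Since
  monomials of size above \<open>n\<close> contribute 0 to coefficient \<open>n\<close>, any larger
  bound \<open>N\<close> gives the same value; all coefficients up to \<open>N\<close> then share
  one index set, which makes convolutions manageable.\<close>

lemma fps_nth_mfps_subst:
  fixes F :: "('v, 'a :: comm_ring_1) mfps"
  assumes "finite V" "\<And>v. v \<in> V \<Longrightarrow> fps_nth (g v) 0 = 0" "n \<le> N"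
  shows "fps_nth (mfps_subst V g F) n =
    (\<Sum>M | set_mset M \<subseteq> V \<and> size M \<le> N. mfps_coeff F M * fps_nth (\<Prod>v\<in>#M. g v) n)"
  unfolding mfps_subst_def fps_nth_Abs_fps
proof (rule sum.mono_neutral_left)
  show "\<forall>M\<in>{M. set_mset M \<subseteq> V \<and> size M \<le> N} - {M. set_mset M \<subseteq> V \<and> size M \<le> n}.
      mfps_coeff F M * fps_nth (\<Prod>v\<in>#M. g v) n = 0"
  proof
    fix M assume M: "M \<in> {M. set_mset M \<subseteq> V \<and> size M \<le> N} - {M. set_mset M \<subseteq> V \<and> size M \<le> n}"
    have "fps_nth (\<Prod>v\<in>#M. g v) n = 0"
      by (rule fps_nth_prod_mset_eq_0) (use M assms(2) in auto)
    then show "mfps_coeff F M * fps_nth (\<Prod>v\<in>#M. g v) n = 0" by simp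
  qed
qed (use assms finite_bounded_multisets in auto)

lemma mfps_subst_add: "mfps_subst V g (F + G) = mfps_subst V g F + mfps_subst V g G"
  by (rule fps_ext) (simp add: mfps_subst_def distrib_right sum.distrib)

lemma mfps_subst_0: "mfps_subst V g 0 = 0"
  by (rule fps_ext) (simp add: mfps_subst_def)

lemma mfps_subst_sum: "mfps_subst V g (\<Sum>i\<in>I. F i) = (\<Sum>i\<in>I. mfps_subst V g (F i))"
  by (induction I rule: infinite_finite_induct) (auto simp: mfps_subst_0 mfps_subst_add)

lemma mfps_subst_1:
  assumes "finite V"
  shows "mfps_subst V g 1 = 1"
proof (rule fps_ext)
  fix n
  have "fps_nth (mfps_subst V g 1) n =
      (\<Sum>M\<in>{{#}}. mfps_coeff 1 M * fps_nth (\<Prod>v\<in>#M. g v) n)"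
    unfolding mfps_subst_def fps_nth_Abs_fps
    by (rule sum.mono_neutral_right)
       (use finite_bounded_multisets[OF assms] in \<open>auto simp: mfps_coeff_1\<close>)
  then show "fps_nth (mfps_subst V g 1) n = fps_nth 1 n"
    by (simp add: mfps_coeff_1)
qed

lemma mfps_subst_var:
  assumes "finite V" "v \<in> V" "fps_nth (g v) 0 = 0"
  shows "mfps_subst V g (mfps_var v) = g v"
proof (rule fps_ext)
  fix n
  have "fps_nth (mfps_subst V g (mfps_var v)) n =
      (\<Sum>M\<in>{M. M = {#v#} \<and> n > 0}. mfps_coeff (mfps_var v) M * fps_nth (\<Prod>v\<in>#M. g v) n)"
    unfolding mfps_subst_def fps_nth_Abs_fps
    by (rule sum.mono_neutral_right)
       (use finite_bounded_multisets[OF assms(1)] assms(2) in \<open>auto simp: mfps_coeff_var\<close>)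
  also have "\<dots> = fps_nth (g v) n"
    using assms(3) by (cases n) (auto simp: mfps_coeff_var)
  finally show "fps_nth (mfps_subst V g (mfps_var v)) n = fps_nth (g v) n" .
qed

text \<open>Both sides are sums over pairs of monomials, because substitution turns
  \<open>X + Y\<close> into the product of the images of \<open>X\<close> and \<open>Y\<close>.
  Monomials with variables outside \<open>V\<close> are dropped consistently, as
  \<open>X + Y\<close> lies over \<open>V\<close> exactly when \<open>X\<close> and \<open>Y\<close>
  do.\<close>

lemma mfps_subst_mult:
  fixes F G :: "('v, 'a :: comm_ring_1) mfps"
  assumes V: "finite V" and g: "\<And>v. v \<in> V \<Longrightarrow> fps_nth (g v) 0 = 0"
  shows "mfps_subst V g (F * G) = mfps_subst V g F * mfps_subst V g G"
proof (rule fps_ext)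
  fix n
  define B where "B = {M. set_mset M \<subseteq> V \<and> size M \<le> n}"
  define P where "P = (\<lambda>M. \<Prod>v\<in>#M. g v)"
  define c where "c = (\<lambda>(X, Y). mfps_coeff F X * mfps_coeff G Y * fps_nth (P (X + Y)) n)"
  have fin: "finite B"
    unfolding B_def by (rule finite_bounded_multisets[OF V])
  have nth: "fps_nth (mfps_subst V g H) i = (\<Sum>M\<in>B. mfps_coeff H M * fps_nth (P M) i)"
    if "i \<le> n" for i and H :: "('v, 'a) mfps"
    unfolding B_def P_def by (rule fps_nth_mfps_subst[OF V g that])
  have "fps_nth (mfps_subst V g F * mfps_subst V g G) n =
      (\<Sum>i=0..n. (\<Sum>X\<in>B. mfps_coeff F X * fps_nth (P X) i) *
                (\<Sum>Y\<in>B. mfps_coeff G Y * fps_nth (P Y) (n - i)))"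
    by (simp add: fps_mult_nth nth)
  also have "\<dots> = (\<Sum>i=0..n. \<Sum>X\<in>B. \<Sum>Y\<in>B.
      mfps_coeff F X * mfps_coeff G Y * (fps_nth (P X) i * fps_nth (P Y) (n - i)))"
    by (simp add: sum_product mult_ac)
  also have "\<dots> = (\<Sum>X\<in>B. \<Sum>i=0..n. \<Sum>Y\<in>B.
      mfps_coeff F X * mfps_coeff G Y * (fps_nth (P X) i * fps_nth (P Y) (n - i)))"
    by (rule sum.swap)
  also have "\<dots> = (\<Sum>X\<in>B. \<Sum>Y\<in>B. \<Sum>i=0..n.
      mfps_coeff F X * mfps_coeff G Y * (fps_nth (P X) i * fps_nth (P Y) (n - i)))"
    by (rule sum.cong[OF refl sum.swap])
  \<comment> \<open>The inner convolution is coefficient \<open>n\<close> of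
    \<open>P X * P Y = P (X + Y)\<close>.\<close>
  also have "\<dots> = (\<Sum>X\<in>B. \<Sum>Y\<in>B. c (X, Y))"
    by (simp add: c_def P_def fps_mult_nth sum_distrib_left)
  also have "\<dots> = (\<Sum>p\<in>B \<times> B. c p)"
    by (simp add: sum.cartesian_product)
  \<comment> \<open>Pairs of total degree above \<open>n\<close> contribute 0; conversely
    \<open>X + Y \<in> B\<close> forces both \<open>X\<close> and \<open>Y\<close> into
    \<open>B\<close>.\<close>
  also have "\<dots> = (\<Sum>p\<in>{(X, Y). X + Y \<in> B}. c p)"
  proof (rule sum.mono_neutral_right)
    have "c (X, Y) = 0" if "X \<in> B" "Y \<in> B" "X + Y \<notin> B" for X Y
    proof -
      have "fps_nth (P (X + Y)) n = 0"
        unfolding P_def by (rule fps_nth_prod_mset_eq_0) (use that g in \<open>auto simp: B_def\<close>)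
      then show ?thesis by (simp add: c_def)
    qed
    then show "\<forall>p\<in>B \<times> B - {(X, Y). X + Y \<in> B}. c p = 0"
      by auto
  qed (use fin in \<open>auto simp: B_def\<close>)
  also have "\<dots> = (\<Sum>q\<in>(SIGMA M:B. {(X, Y). X + Y = M}). c (snd q))"
    by (rule sum.reindex_bij_witness[where i = snd and j = "\<lambda>p. (fst p + snd p, p)"]) auto
  also have "\<dots> = (\<Sum>M\<in>B. \<Sum>p\<in>{(X, Y). X + Y = M}. c p)"
    by (subst sum.Sigma) (auto simp: fin finite_mset_antidiagonal [unfolded case_prod_unfold] case_prod_unfold)
  also have "\<dots> = fps_nth (mfps_subst V g (F * G)) n"
    by (auto simp: nth mfps_coeff_mult c_def sum_distrib_right intro!: sum.cong)
  finally show "fps_nth (mfps_subst V g (F * G)) n =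
      fps_nth (mfps_subst V g F * mfps_subst V g G) n" ..
qed

lemma mfps_subst_power:
  fixes F :: "('v, 'a :: comm_ring_1) mfps"
  assumes "finite V" "\<And>v. v \<in> V \<Longrightarrow> fps_nth (g v) 0 = 0"
  shows "mfps_subst V g (F ^ n) = mfps_subst V g F ^ n"
  by (induction n) (simp_all add: mfps_subst_1 mfps_subst_mult assms)

text \<open>Under the alternating substitution the defining relation of \<open>G\<close> degenerates
  to 0 = 0, so the sum of the variables must be cancelled beforehand. This is legitimate because
  that sum is not a zero divisor.\<close>

lemma geode_functional_equation:
  fixes S G :: "(nat, 'a :: comm_ring_1) mfps"
  assumes "m > 0"
    and S: "0 = 1 - S + (\<Sum>k = 1..m. mfps_var k * S ^ (k + 1))"
    and G: "S - 1 = (\<Sum>k = 1..m. mfps_var k) * G"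
  shows "G = 1 + (\<Sum>k = 1..m. mfps_var k * (\<Sum>i<k + 1. S ^ i)) * G"
proof -
  define T :: "(nat, 'a) mfps" where "T = (\<Sum>k = 1..m. mfps_var k)"
  define U where "U = (\<Sum>k = 1..m. mfps_var k * (\<Sum>i<k + 1. S ^ i))"
  \<comment> \<open>The geometric sum splits off a factor \<open>S - 1\<close>, which is later
    replaced by \<open>T * G\<close>.\<close>
  have pow: "S ^ (k + 1) = 1 + (S - 1) * (\<Sum>i<k + 1. S ^ i)" for k
    using power_diff_1_eq[of S "k + 1"] by (metis add.commute diff_add_cancel)
  have "S - 1 = (\<Sum>k = 1..m. mfps_var k * S ^ (k + 1))"
    using S by (simp add: algebra_simps)
  also have "\<dots> = T + (S - 1) * U"
    unfolding pow T_def U_def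
    by (simp only: distrib_left mult_1_right sum.distrib sum_distrib_left mult.left_commute)
  finally have "T * G = T + T * G * U"
    using G by (simp add: T_def)
  then have "T * (G - (1 + U * G)) = 0"
    by (simp add: algebra_simps)
  \<comment> \<open>Cancellation asks for some variable occurring in \<open>T\<close>; index 1 is
    available because \<open>m > 0\<close>.\<close>
  then have "G - (1 + U * G) = 0"
    unfolding T_def by (rule mfps_sum_var_mult_cancel[of "{1..m}" 1, rotated 2]) (use \<open>m > 0\<close> in auto)
  then show ?thesis unfolding right_minus_eq U_def .
qed

lemma sum_alternating_atLeast1_even:
  fixes x :: "'a :: comm_ring_1" and a :: nat
  shows "(\<Sum>k = 1..2 * a. if odd k then - x else x) = 0"
  by (induction a) auto

text \<open>The terms for \<open>k = 2j - 1\<close> and \<open>k = 2j\<close> add up to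
  \<open>- 2j x + (2j + 1) x = x\<close>, and there are \<open>a\<close> such pairs.\<close>

lemma sum_alternating_Suc_atLeast1_even:
  fixes x :: "'a :: comm_ring_1" and a :: nat
  shows "(\<Sum>k = 1..2 * a. (if odd k then - x else x) * of_nat (k + 1)) = of_nat a * x"
  by (induction a) (auto simp: algebra_simps)

theorem theorem3p1:
  fixes a :: nat and S G :: "(nat, rat) mfps"
  assumes "a > 0"
    and "S \<in> mfps_in {1..2 * a}"
    and "mfps_const_term S = 1"
    and "0 = 1 - S + (\<Sum>k = 1..2 * a. mfps_var k * S ^ (k + 1))"
    and "G \<in> mfps_in {1..2 * a}"
    and "S - 1 = (\<Sum>k = 1..2 * a. mfps_var k) * G"
  shows "mfps_subst {1..2 * a} (\<lambda>k. if odd k then - fps_X else fps_X) G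
           = Abs_fps (\<lambda>n. of_nat a ^ n)"
proof -
  define g :: "nat \<Rightarrow> rat fps" where "g = (\<lambda>k. if odd k then - fps_X else fps_X)"
  define \<phi> where "\<phi> = mfps_subst {1..2 * a} g"
  have g0: "fps_nth (g k) 0 = 0" for k
    by (simp add: g_def)
  have mult: "\<phi> (F * H) = \<phi> F * \<phi> H" and power: "\<phi> (F ^ n) = \<phi> F ^ n" for F H n
    unfolding \<phi>_def by (simp_all add: mfps_subst_mult mfps_subst_power g0)
  have add: "\<phi> (F + H) = \<phi> F + \<phi> H" and one: "\<phi> 1 = 1" for F H
    unfolding \<phi>_def by (simp_all add: mfps_subst_add mfps_subst_1)
  have sum: "\<phi> (\<Sum>i\<in>I. F i) = (\<Sum>i\<in>I. \<phi> (F i))" for F and I :: "nat set"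
    unfolding \<phi>_def by (rule mfps_subst_sum)
  \<comment> \<open>The range condition matters: \<open>\<phi>\<close> sends variables with other
    indices to 0.\<close>
  have var: "\<phi> (mfps_var k) = g k" if "k \<in> {1..2 * a}" for k
    unfolding \<phi>_def using that by (intro mfps_subst_var g0) auto
  have "\<phi> (\<Sum>k = 1..2 * a. mfps_var k) = (\<Sum>k = 1..2 * a. g k)"
    unfolding sum by (rule sum.cong) (simp_all add: var)
  also have "\<dots> = 0"
    unfolding g_def by (rule sum_alternating_atLeast1_even)
  finally have T: "\<phi> (\<Sum>k = 1..2 * a. mfps_var k) = 0" .
  have "S = 1 + (\<Sum>k = 1..2 * a. mfps_var k) * G"
    using assms(6) by (simp add: algebra_simps)
  from arg_cong[OF this, of \<phi>] have S: "\<phi> S = 1"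
    unfolding add mult one T by simp
  \<comment> \<open>Since \<open>S\<close> is sent to 1, the inner sum becomes \<open>k + 1\<close>
    copies of 1.\<close>
  have "\<phi> (\<Sum>k = 1..2 * a. mfps_var k * (\<Sum>i<k + 1. S ^ i)) =
      (\<Sum>k = 1..2 * a. g k * of_nat (k + 1))"
    unfolding sum mult power S by (rule sum.cong) (simp_all add: var)
  also have "\<dots> = of_nat a * fps_X"
    unfolding g_def by (rule sum_alternating_Suc_atLeast1_even)
  finally have U: "\<phi> (\<Sum>k = 1..2 * a. mfps_var k * (\<Sum>i<k + 1. S ^ i)) = of_nat a * fps_X" .
  have "G = 1 + (\<Sum>k = 1..2 * a. mfps_var k * (\<Sum>i<k + 1. S ^ i)) * G"
    using assms by (intro geode_functional_equation) auto
  from arg_cong[OF this, of \<phi>] have rec: "\<phi> G = 1 + of_nat a * fps_X * \<phi> G"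
    unfolding add mult one U .
  \<comment> \<open>By \<open>rec\<close>, the constant term is 1 and each later coefficient is
    \<open>a\<close> times its predecessor. Since \<open>\<phi> G\<close> recurs on the right of
    \<open>rec\<close>, it is unfolded only once.\<close>
  have "fps_nth (\<phi> G) n = of_nat a ^ n" for n
  proof (induction n)
    case 0
    show ?case by (subst rec) (simp add: mult.assoc)
  next
    case (Suc n)
    then show ?case
      by (subst rec) (simp add: mult.assoc fps_of_nat[symmetric])
  qed
  then show ?thesis
    by (intro fps_ext) (simp add: \<phi>_def g_def)
qed

end
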